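(* Let $x:[0,1]\to\mathbb{R}^d$ be a path with velocity $v=\dot x$ and acceleration $a=\dot v$. The trajectory $x$ is straight if and only if its velocity direction is time invariant and its acceleration is everywhere parallel to its velocity. Moreover, the classical (first-order) dynamical optimal transport motion is recovered as the special case of zero acceleration: if $a\equiv 0$, then $x(t)=x(0)+t\,v(0)$ for all $t\in[0,1]$, i.e. straight motion at constant velocity.
   Context: Paths are $x:[0,1]\to\mathbb{R}^d$ such that $x$ and its velocity $v=\dot x$ are absolutely continuous; $a=\dot v$ is then defined for almost every $t$, and statements about $a(t)$ are understood at those $t$ where it is defined. The trajectory is straight if there exist a unit vector $u\in\mathbb{R}^d$ and a scalar function $s:[0,1]\to\mathbb{R}$ such that $x(t)=x(0)+s(t)\,u$ for all $t\in[0,1]$. For $\|v(t)\|>0$ the unit direction of motion is $\mathbf{s}(t)=v(t)/\|v(t)\|$. The velocity direction is time invariant if there is a fixed unit vector $u$ and a scalar function $\alpha$ with $v(t)=\alpha(t)\,u$ for all $t\in[0,1]$; equivalently $\mathbf{s}(t)\in\{u,-u\}$ whenever $\|v(t)\|>0$ (sign changes can occur only across instants where $v=0$, and at instants where $v(t)=0$ the direction is immaterial). The acceleration is parallel to the velocity at $t$ if $v(t)=0$ (trivially satisfied) or if $a(t)$ is a scalar multiple of $v(t)$, i.e. $a_\perp(t):=a(t)-(\mathbf{s}(t)\cdot a(t))\,\mathbf{s}(t)=0$. *)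

theory Defs
  imports "HOL-Analysis.Analysis"
begin

(* The usual epsilon-delta definition: finite families of non-overlapping subintervals of {l..r}
   of small total length carry small total variation. (The constant absolutely_continuous of
   HOL-Analysis is about measures.) *)
definition abs_continuous_on :: "real \<Rightarrow> real \<Rightarrow> (real \<Rightarrow> 'a::real_normed_vector) \<Rightarrow> bool" where
  "abs_continuous_on l r f \<longleftrightarrow>
     (\<forall>\<epsilon>>0. \<exists>\<delta>>0. \<forall>(n::nat) (p::nat \<Rightarrow> real) (q::nat \<Rightarrow> real).
        (\<forall>i<n. l \<le> p i \<and> p i \<le> q i \<and> q i \<le> r) \<and>
        disjoint_family_on (\<lambda>i. {p i<..<q i}) {..<n} \<and>
        (\<Sum>i<n. q i - p i) < \<delta> \<longrightarrow>
        (\<Sum>i<n. norm (f (q i) - f (p i))) < \<epsilon>)"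

(* Derivatives are taken within {0..1}, hence one-sided at the end points; values of x outside
   {0..1} are irrelevant. vector_derivative is unspecified where no derivative exists. *)
definition velocity :: "(real \<Rightarrow> 'a::real_normed_vector) \<Rightarrow> real \<Rightarrow> 'a" where
  "velocity x t = vector_derivative x (at t within {0..1})"

definition acceleration :: "(real \<Rightarrow> 'a::real_normed_vector) \<Rightarrow> real \<Rightarrow> 'a" where
  "acceleration x t = vector_derivative (velocity x) (at t within {0..1})"

definition acceleration_defined_at :: "(real \<Rightarrow> 'a::real_normed_vector) \<Rightarrow> real \<Rightarrow> bool" where
  "acceleration_defined_at x t \<longleftrightarrow> velocity x differentiable (at t within {0..1})"

definition motion_path :: "(real \<Rightarrow> 'a::real_normed_vector) \<Rightarrow> bool" where
  "motion_path x \<longleftrightarrow>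
     abs_continuous_on 0 1 x \<and>
     (\<forall>t\<in>{0..1}. x differentiable (at t within {0..1})) \<and>
     abs_continuous_on 0 1 (velocity x)"

definition straight :: "(real \<Rightarrow> 'a::real_normed_vector) \<Rightarrow> bool" where
  "straight x \<longleftrightarrow>
     (\<exists>(u::'a) (s::real \<Rightarrow> real). norm u = 1 \<and> (\<forall>t\<in>{0..1}. x t = x 0 + s t *\<^sub>R u))"

definition direction_time_invariant :: "(real \<Rightarrow> 'a::real_normed_vector) \<Rightarrow> bool" where
  "direction_time_invariant x \<longleftrightarrow>
     (\<exists>(u::'a) (\<alpha>::real \<Rightarrow> real). norm u = 1 \<and> (\<forall>t\<in>{0..1}. velocity x t = \<alpha> t *\<^sub>R u))"

definition acceleration_parallel_at :: "(real \<Rightarrow> 'a::real_normed_vector) \<Rightarrow> real \<Rightarrow> bool" where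
  "acceleration_parallel_at x t \<longleftrightarrow>
     velocity x t = 0 \<or> (\<exists>c::real. acceleration x t = c *\<^sub>R velocity x t)"

definition acceleration_everywhere_parallel :: "(real \<Rightarrow> 'a::real_normed_vector) \<Rightarrow> bool" where
  "acceleration_everywhere_parallel x \<longleftrightarrow>
     (\<forall>t\<in>{0..1}. acceleration_defined_at x t \<longrightarrow> acceleration_parallel_at x t)"

definition zero_acceleration :: "(real \<Rightarrow> 'a::real_normed_vector) \<Rightarrow> bool" where
  "zero_acceleration x \<longleftrightarrow>
     (\<forall>t\<in>{0..1}. acceleration_defined_at x t \<longrightarrow> acceleration x t = 0)"

(* The unit direction of motion v / |v| is sgn (velocity x t). *)
lemma direction_time_invariant_iff_sgn:
  fixes x :: "real \<Rightarrow> real ^ 'd"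
  shows "direction_time_invariant x \<longleftrightarrow>
    (\<exists>u. norm u = 1 \<and> (\<forall>t\<in>{0..1}. velocity x t \<noteq> 0 \<longrightarrow> sgn (velocity x t) \<in> {u, - u}))"
proof
  assume "direction_time_invariant x"
  then obtain u \<alpha> where u: "norm u = 1" and v: "\<And>t. t \<in> {0..1} \<Longrightarrow> velocity x t = \<alpha> t *\<^sub>R u"
    unfolding direction_time_invariant_def by blast
  have "sgn (velocity x t) \<in> {u, - u}" if "t \<in> {0..1}" "velocity x t \<noteq> 0" for t
    using v[OF that(1)] that(2) u by (auto simp: sgn_scaleR sgn_div_norm[of u] sgn_real_def)
  with u show "\<exists>u. norm u = 1 \<and> (\<forall>t\<in>{0..1}. velocity x t \<noteq> 0 \<longrightarrow> sgn (velocity x t) \<in> {u, - u})"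
    by blast
next
  assume "\<exists>u. norm u = 1 \<and> (\<forall>t\<in>{0..1}. velocity x t \<noteq> 0 \<longrightarrow> sgn (velocity x t) \<in> {u, - u})"
  then obtain u where u: "norm u = 1"
    and s: "\<And>t. t \<in> {0..1} \<Longrightarrow> velocity x t \<noteq> 0 \<Longrightarrow> sgn (velocity x t) \<in> {u, - u}"
    by blast
  have "\<exists>k. velocity x t = k *\<^sub>R u" if t: "t \<in> {0..1}" for t
  proof (cases "velocity x t = 0")
    case True
    then show ?thesis by (intro exI[of _ 0]) simp
  next
    case False
    have e: "velocity x t = norm (velocity x t) *\<^sub>R sgn (velocity x t)"
      using False by (simp add: sgn_div_norm)
    from s[OF t False] show ?thesis
    proof (elim insertE emptyE)
      assume "sgn (velocity x t) = u"
      with e show ?thesis by metis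
    next
      assume "sgn (velocity x t) = - u"
      with e have "velocity x t = (- norm (velocity x t)) *\<^sub>R u" by simp
      then show ?thesis by blast
    qed
  qed
  then obtain \<alpha> where "\<forall>t\<in>{0..1}. velocity x t = \<alpha> t *\<^sub>R u" by metis
  with u show "direction_time_invariant x" unfolding direction_time_invariant_def by blast
qed

lemma acceleration_parallel_at_iff_perp_zero:
  fixes x :: "real \<Rightarrow> real ^ 'd"
  assumes "velocity x t \<noteq> 0"
  shows "acceleration_parallel_at x t \<longleftrightarrow>
    acceleration x t - (sgn (velocity x t) \<bullet> acceleration x t) *\<^sub>R sgn (velocity x t) = 0"
proof
  assume "acceleration_parallel_at x t"
  with assms obtain c where c: "acceleration x t = c *\<^sub>R velocity x t"
    unfolding acceleration_parallel_at_def by blast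
  show "acceleration x t - (sgn (velocity x t) \<bullet> acceleration x t) *\<^sub>R sgn (velocity x t) = 0"
    using assms unfolding c
    by (simp add: sgn_div_norm dot_square_norm power2_eq_square)
next
  assume "acceleration x t - (sgn (velocity x t) \<bullet> acceleration x t) *\<^sub>R sgn (velocity x t) = 0"
  then have "acceleration x t
      = ((sgn (velocity x t) \<bullet> acceleration x t) * inverse (norm (velocity x t))) *\<^sub>R velocity x t"
    by (simp add: sgn_div_norm)
  then show "acceleration_parallel_at x t" unfolding acceleration_parallel_at_def by blast
qed

end

theory Submission
  imports Defs
begin

text \<open>
  Along a straight path the component of x orthogonal to u is constant, so its derivatives, the
  orthogonal components of velocity and acceleration, vanish; conversely, if the orthogonal component
  of the velocity vanishes, that of x is constant. The condition on the acceleration is therefore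
  implied by the one on the direction.

  The case of zero acceleration is deeper, since the acceleration is constrained only where it exists:
  one needs that an absolutely continuous v is differentiable almost everywhere. The proof follows
  Austin's geometric proof of the Lebesgue differentiation theorem. After subtracting a linear function
  it suffices to show that the set of points with arbitrarily short chords of slope above \<open>\<alpha>\<close> and
  others of slope below \<open>-\<alpha>\<close> is negligible. Take a partition whose variation is within
  \<open>e\<alpha>\<close> of the supremum. By Vitali's theorem almost all of the set is covered by disjoint
  chords whose slope has the sign opposite to that of the surrounding partition interval; refining the
  partition by these chords increases the variation by twice theirs, so their total length
  is at most e. Constancy of an absolutely continuous function whose derivative vanishes almost
  everywhere then follows with a fine tagged division.
\<close>

section \<open>Finite families of non-overlapping intervals\<close>

text \<open>Intervals are stored as endpoint pairs, so that refinements are unions of sets and sums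
  need no enumeration. Neighbours may share an endpoint; the strict \<open>p < q\<close> makes
  packings of adjacent intervals disjoint as sets of pairs.\<close>

definition packing :: "real \<Rightarrow> real \<Rightarrow> (real \<times> real) set \<Rightarrow> bool" where
  "packing a b D \<longleftrightarrow> finite D \<and> (\<forall>(p, q)\<in>D. a \<le> p \<and> p < q \<and> q \<le> b) \<and>
     pairwise (\<lambda>(p, q) (p', q'). q \<le> p' \<or> q' \<le> p) D"

lemma packing_empty: "packing a b {}"
  by (simp add: packing_def)

lemma packing_finite: "packing a b D \<Longrightarrow> finite D"
  by (simp add: packing_def)

lemma packing_bounds: "packing a b D \<Longrightarrow> (p, q) \<in> D \<Longrightarrow> a \<le> p \<and> p < q \<and> q \<le> b"
  by (auto simp: packing_def)

lemma packing_disjoint: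
  "packing a b D \<Longrightarrow> (p, q) \<in> D \<Longrightarrow> (p', q') \<in> D \<Longrightarrow> (p, q) \<noteq> (p', q') \<Longrightarrow> q \<le> p' \<or> q' \<le> p"
  unfolding packing_def pairwise_def by fast

lemma packing_restrict:
  "packing a b D \<Longrightarrow> packing p q {(u, v) \<in> D. p \<le> u \<and> v \<le> q}"
  unfolding packing_def pairwise_def by (auto elim: rev_finite_subset)

lemma packing_Un:
  assumes "packing a c D" "packing c b E" "a \<le> c" "c \<le> b"
  shows "packing a b (D \<union> E)" "D \<inter> E = {}"
proof -
  have D: "finite D" "\<And>p q. (p, q) \<in> D \<Longrightarrow> a \<le> p \<and> p < q \<and> q \<le> c"
    and E: "finite E" "\<And>p q. (p, q) \<in> E \<Longrightarrow> c \<le> p \<and> p < q \<and> q \<le> b"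
    using assms by (auto simp: packing_def)
  show "D \<inter> E = {}"
    using D(2) E(2) by fastforce
  have "q \<le> p' \<or> q' \<le> p" if "(p, q) \<in> D \<union> E" "(p', q') \<in> D \<union> E" "(p, q) \<noteq> (p', q')" for p q p' q'
    using that D(2)[of p q] E(2)[of p q] D(2)[of p' q'] E(2)[of p' q']
      packing_disjoint[OF assms(1), of p q p' q'] packing_disjoint[OF assms(2), of p q p' q']
    by auto
  moreover have "a \<le> p \<and> p < q \<and> q \<le> b" if "(p, q) \<in> D \<union> E" for p q
    using that D(2)[of p q] E(2)[of p q] assms(3,4) by auto
  ultimately show "packing a b (D \<union> E)"
    unfolding packing_def pairwise_def using D(1) E(1) by blast
qed

text \<open>Induction on the number of intervals: any member splits the rest into a left and a right
  packing, each of which is completed separately. The identity for every \<open>f\<close> encodes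
  that \<open>E\<close> subdivides [a,b]. The cover is guarded by \<open>a < b\<close>, since for
  \<open>a = b\<close> the only packing is empty and misses the point.\<close>

lemma packing_extend:
  assumes "packing a b D" "a \<le> b"
  shows "\<exists>E. D \<subseteq> E \<and> packing a b E \<and> (\<forall>f::real \<Rightarrow> real. (\<Sum>(p, q)\<in>E. f q - f p) = f b - f a) \<and>
    (a < b \<longrightarrow> {a..b} \<subseteq> (\<Union>(p, q)\<in>E. {p..q}))"
  using assms
proof (induction "card D" arbitrary: a b D rule: less_induct)
  case less
  note fin = packing_finite[OF less.prems(1)]
  show ?case
  proof (cases "D = {}")
    case True
    show ?thesis
    proof (cases "a < b")
      case True
      then show ?thesis using \<open>D = {}\<close>
        by (intro exI[of _ "{(a, b)}"]) (auto simp: packing_def)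
    next
      case False
      then show ?thesis using \<open>D = {}\<close> less.prems(2)
        by (intro exI[of _ "{}"]) (auto simp: packing_def)
    qed
  next
    case False
    then obtain p q where pq: "(p, q) \<in> D" by auto
    define L R where "L = {(u, v) \<in> D. a \<le> u \<and> v \<le> p}" and "R = {(u, v) \<in> D. q \<le> u \<and> v \<le> b}"
    note b = packing_bounds[OF less.prems(1)]
    have [simp]: "p < q" "a \<le> p" "q \<le> b" using b[OF pq] by auto
    have sub: "L \<subseteq> D" "R \<subseteq> D" "(p, q) \<notin> L" "(p, q) \<notin> R"
      using \<open>p < q\<close> by (auto simp: L_def R_def simp flip: not_less)
    \<comment> \<open>Every other interval lies on one side of \<open>(p, q)\<close>, so nothing is
      lost by the split.\<close>
    have DD: "D \<subseteq> L \<union> {(p, q)} \<union> R"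
      using packing_disjoint[OF less.prems(1) _ pq] b unfolding L_def R_def by blast
    have pL: "packing a p L" and pR: "packing q b R"
      unfolding L_def R_def by (intro packing_restrict[OF less.prems(1)])+
    have "card L < card D" "card R < card D"
      using sub pq fin by (auto intro!: psubset_card_mono)
    from less.hyps[OF this(1) pL] less.hyps[OF this(2) pR]
    obtain L' R' where L': "L \<subseteq> L'" "packing a p L'" "\<And>f::real \<Rightarrow> real. (\<Sum>(p, q)\<in>L'. f q - f p) = f p - f a"
        "a < p \<longrightarrow> {a..p} \<subseteq> (\<Union>(p, q)\<in>L'. {p..q})"
      and R': "R \<subseteq> R'" "packing q b R'" "\<And>f::real \<Rightarrow> real. (\<Sum>(p, q)\<in>R'. f q - f p) = f b - f q"
        "q < b \<longrightarrow> {q..b} \<subseteq> (\<Union>(p, q)\<in>R'. {p..q})"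
      by auto
    have one: "packing p q {(p, q)}" by (simp add: packing_def)
    note U1 = packing_Un[OF L'(2) one]
    have P1: "packing a q (L' \<union> {(p, q)})" "L' \<inter> {(p, q)} = {}" using U1 \<open>p < q\<close> \<open>a \<le> p\<close> by auto
    have P2: "packing a b (L' \<union> {(p, q)} \<union> R')" "(L' \<union> {(p, q)}) \<inter> R' = {}"
      using packing_Un[OF P1(1) R'(2)] \<open>p < q\<close> \<open>a \<le> p\<close> by auto
    have "(\<Sum>(p, q)\<in>L' \<union> {(p, q)} \<union> R'. f q - f p) = f b - f a" for f :: "real \<Rightarrow> real"
      using P1(2) P2(2) packing_finite[OF L'(2)] packing_finite[OF R'(2)]
      by (simp add: sum.union_disjoint L'(3) R'(3) del: Un_insert_right Un_insert_left)
    moreover have "{a..b} \<subseteq> (\<Union>(p, q)\<in>L' \<union> {(p, q)} \<union> R'. {p..q})"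
    proof
      fix x assume x: "x \<in> {a..b}"
      consider "a < p" "x \<in> {a..p}" | "x \<in> {p..q}" | "q < b" "x \<in> {q..b}"
        using x by fastforce
      then show "x \<in> (\<Union>(p, q)\<in>L' \<union> {(p, q)} \<union> R'. {p..q})"
        using L'(4) R'(4) by cases blast+
    qed
    ultimately show ?thesis
      using P2(1) DD L'(1) R'(1) by (intro exI[of _ "L' \<union> {(p, q)} \<union> R'"]) blast
  qed
qed

text \<open>Length is the increment of the identity function, which telescopes over a completed
  packing.\<close>

lemma packing_sum_length_le:
  assumes "packing a b D" "a \<le> b"
  shows "(\<Sum>(p, q)\<in>D. q - p) \<le> b - a"
proof -
  obtain E where E: "D \<subseteq> E" "packing a b E"
      and tele: "\<forall>f::real \<Rightarrow> real. (\<Sum>(p, q)\<in>E. f q - f p) = f b - f a"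
    using packing_extend[OF assms] by blast
  have "(\<Sum>(p, q)\<in>D. q - p) \<le> (\<Sum>(p, q)\<in>E. q - p)"
    using E packing_bounds[OF E(2)] packing_finite[OF E(2)]
    by (intro sum_mono2) force+
  also have "\<dots> = b - a" using spec[OF tele, of "\<lambda>t. t"] .
  finally show ?thesis .
qed

text \<open>
  Inside an interval of E where f rises, chords along which f falls by h force the subdivision
  through them to have variation larger by 2h, the compensating rise being counted as well.
\<close>

lemma packing_sum_variation_refine:
  fixes f :: "real \<Rightarrow> real"
  assumes bound: "\<And>D. packing a b D \<Longrightarrow> (\<Sum>(p, q)\<in>D. \<bar>f q - f p\<bar>) \<le> B"
    and E: "packing a b E" and D: "packing a b D"
    and opposite: "\<And>u v. (u, v) \<in> D \<Longrightarrow> \<exists>p q. (p, q) \<in> E \<and> p \<le> u \<and> v \<le> q \<and>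
      (0 \<le> f q - f p \<and> f v - f u \<le> 0 \<or> f q - f p < 0 \<and> 0 \<le> f v - f u)"
  shows "(\<Sum>(p, q)\<in>E. \<bar>f q - f p\<bar>) + 2 * (\<Sum>(u, v)\<in>D. \<bar>f v - f u\<bar>) \<le> B"
proof -
  \<comment> \<open>\<open>Dk k\<close> collects the chords inside the piece \<open>k\<close> of
    \<open>E\<close>. Completing each of these families to a subdivision \<open>Ek k\<close> of
    \<open>k\<close> produces the refinement of \<open>E\<close> to which \<open>bound\<close> is
    applied.\<close>
  define Dk where "Dk = (\<lambda>k. {(u, v) \<in> D. fst k \<le> u \<and> v \<le> snd k})"
  have pDk: "packing (fst k) (snd k) (Dk k)" for k
    unfolding Dk_def by (rule packing_restrict[OF D])
  have kE: "a \<le> fst k" "fst k < snd k" "snd k \<le> b" if "k \<in> E" for k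
    using packing_bounds[OF E, of "fst k" "snd k"] that by auto
  have "\<exists>F. Dk k \<subseteq> F \<and> packing (fst k) (snd k) F \<and>
      (\<forall>f::real \<Rightarrow> real. (\<Sum>(p, q)\<in>F. f q - f p) = f (snd k) - f (fst k))" if "k \<in> E" for k
    using packing_extend[OF pDk[of k]] kE[OF that] by auto
  then obtain Ek where Ek: "\<And>k. k \<in> E \<Longrightarrow> Dk k \<subseteq> Ek k"
      "\<And>k. k \<in> E \<Longrightarrow> packing (fst k) (snd k) (Ek k)"
      "\<And>k (f::real \<Rightarrow> real). k \<in> E \<Longrightarrow> (\<Sum>(p, q)\<in>Ek k. f q - f p) = f (snd k) - f (fst k)"
    by metis
  have eb: "fst k \<le> u \<and> u < v \<and> v \<le> snd k" if "k \<in> E" "(u, v) \<in> Ek k" for k u v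
    using packing_bounds[OF Ek(2)] that by blast
  have dis: "snd k \<le> fst k' \<or> snd k' \<le> fst k" if "k \<in> E" "k' \<in> E" "k \<noteq> k'" for k k'
    using packing_disjoint[OF E, of "fst k" "snd k" "fst k'" "snd k'"] that by auto
  have disE: "Ek k \<inter> Ek k' = {}" if "k \<in> E" "k' \<in> E" "k \<noteq> k'" for k k'
    using eb[OF that(1)] eb[OF that(2)] dis[OF that] by fastforce
  have finE: "finite E" using packing_finite[OF E] .
  have finEk: "finite (Ek k)" if "k \<in> E" for k using packing_finite[OF Ek(2)[OF that]] .
  have finDk: "finite (Dk k)" for k using packing_finite[OF pDk] .
  have gain: "\<bar>f (snd k) - f (fst k)\<bar> + 2 * (\<Sum>(u, v)\<in>Dk k. \<bar>f v - f u\<bar>) \<le> (\<Sum>(u, v)\<in>Ek k. \<bar>f v - f u\<bar>)"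
    if k: "k \<in> E" for k
  proof -
    \<comment> \<open>\<open>s\<close> is the direction in which \<open>f\<close> changes over
      \<open>k\<close>. The increments times \<open>s\<close> telescope to the absolute change over
      \<open>k\<close>, and the chords in \<open>Dk k\<close> enter this sum negatively; passing to
      absolute values therefore gains twice their variation.\<close>
    define s :: real where "s = (if 0 \<le> f (snd k) - f (fst k) then 1 else - 1)"
    have sk: "\<bar>f (snd k) - f (fst k)\<bar> = s * (f (snd k) - f (fst k))"
      by (auto simp: s_def)
    have opp: "s * (f v - f u) = - \<bar>f v - f u\<bar>" if "(u, v) \<in> Dk k" for u v
    proof -
      have uv: "(u, v) \<in> D" "fst k \<le> u" "v \<le> snd k" using that by (auto simp: Dk_def)
      have "u < v" using packing_bounds[OF D uv(1)] by simp
      obtain p q where pq: "(p, q) \<in> E" "p \<le> u" "v \<le> q"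
        "0 \<le> f q - f p \<and> f v - f u \<le> 0 \<or> f q - f p < 0 \<and> 0 \<le> f v - f u"
        using opposite[OF uv(1)] by blast
      \<comment> \<open>Distinct pieces of \<open>E\<close> cannot both contain the nondegenerate
        interval [u,v].\<close>
      have "k = (p, q)"
        using dis[OF k pq(1)] uv pq(2,3) \<open>u < v\<close> by force
      then show ?thesis using pq(4) by (auto simp: s_def)
    qed
    have "s * (f (snd k) - f (fst k)) = (\<Sum>(u, v)\<in>Ek k. s * (f v - f u))"
      by (simp add: Ek(3)[OF k, of f, symmetric] sum_distrib_left case_prod_unfold)
    also have "\<dots> \<le> (\<Sum>c\<in>Ek k. \<bar>f (snd c) - f (fst c)\<bar> - (if c \<in> Dk k then 2 * \<bar>f (snd c) - f (fst c)\<bar> else 0))"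
    proof (intro sum_mono)
      fix c assume "c \<in> Ek k"
      show "(case c of (u, v) \<Rightarrow> s * (f v - f u)) \<le>
          \<bar>f (snd c) - f (fst c)\<bar> - (if c \<in> Dk k then 2 * \<bar>f (snd c) - f (fst c)\<bar> else 0)"
        using opp[of "fst c" "snd c"] by (cases c) (auto simp: s_def)
    qed
    also have "\<dots> = (\<Sum>(u, v)\<in>Ek k. \<bar>f v - f u\<bar>) - 2 * (\<Sum>(u, v)\<in>Dk k. \<bar>f v - f u\<bar>)"
      using Ek(1)[OF k] finEk[OF k]
      by (simp add: sum_subtractf sum.If_cases Int_absorb1 sum_distrib_left case_prod_unfold)
    finally show ?thesis using sk by linarith
  qed
  have "packing a b (\<Union>k\<in>E. Ek k)"
    unfolding packing_def
  proof (intro conjI)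
    show "finite (\<Union>k\<in>E. Ek k)" using finE finEk by auto
    show "\<forall>(p, q)\<in>(\<Union>k\<in>E. Ek k). a \<le> p \<and> p < q \<and> q \<le> b"
      using eb kE by fastforce
    show "pairwise (\<lambda>(p, q) (p', q'). q \<le> p' \<or> q' \<le> p) (\<Union>k\<in>E. Ek k)"
    proof (rule pairwiseI, clarify)
      fix p q k p' q' k'
      assume a: "k \<in> E" "(p, q) \<in> Ek k" "k' \<in> E" "(p', q') \<in> Ek k'" "\<not> q' \<le> p" "\<not> (p = p' \<and> q = q')"
      show "q \<le> p'"
      proof (cases "k = k'")
        case True
        then show ?thesis using packing_disjoint[OF Ek(2)] a by (metis prod.inject)
      next
        case False
        then show ?thesis using dis[OF a(1,3)] eb[OF a(1,2)] eb[OF a(3,4)] a(5) by linarith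
      qed
    qed
  qed
  then have "(\<Sum>(p, q)\<in>(\<Union>k\<in>E. Ek k). \<bar>f q - f p\<bar>) \<le> B" by (rule bound)
  then have le: "(\<Sum>k\<in>E. \<Sum>(p, q)\<in>Ek k. \<bar>f q - f p\<bar>) \<le> B"
    by (subst (asm) sum.UNION_disjoint) (use finE finEk disE in auto)
  have "D = (\<Union>k\<in>E. Dk k)"
  proof
    show "D \<subseteq> (\<Union>k\<in>E. Dk k)"
      using opposite unfolding Dk_def by fastforce
  qed (auto simp: Dk_def)
  moreover have "(\<Sum>(u, v)\<in>(\<Union>k\<in>E. Dk k). \<bar>f v - f u\<bar>) = (\<Sum>k\<in>E. \<Sum>(u, v)\<in>Dk k. \<bar>f v - f u\<bar>)"
    by (rule sum.UNION_disjoint) (use finE finDk disE Ek(1) in blast)+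
  ultimately have DD: "(\<Sum>(u, v)\<in>D. \<bar>f v - f u\<bar>) = (\<Sum>k\<in>E. \<Sum>(u, v)\<in>Dk k. \<bar>f v - f u\<bar>)" by simp
  have "(\<Sum>(p, q)\<in>E. \<bar>f q - f p\<bar>) + 2 * (\<Sum>(u, v)\<in>D. \<bar>f v - f u\<bar>)
      = (\<Sum>k\<in>E. \<bar>f (snd k) - f (fst k)\<bar> + 2 * (\<Sum>(u, v)\<in>Dk k. \<bar>f v - f u\<bar>))"
    by (subst DD) (simp add: sum.distrib sum_distrib_left case_prod_unfold)
  also have "\<dots> \<le> (\<Sum>k\<in>E. \<Sum>(p, q)\<in>Ek k. \<bar>f q - f p\<bar>)" by (intro sum_mono gain)
  finally show ?thesis using le by linarith
qed

section \<open>Differentiability almost everywhere\<close>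

text \<open>Turns a bound on finite packings by intervals with property \<open>R\<close> into an
  outer measure bound for \<open>S\<close>. Vitali's theorem covers \<open>S\<close> up to a null
  set by countably many disjoint such intervals; finite subfamilies are packings, and the bound
  passes to the countable union.\<close>

lemma Vitali_packing:
  assumes cover: "\<And>x d. x \<in> S \<Longrightarrow> 0 < d \<Longrightarrow>
      \<exists>p q. a \<le> p \<and> p \<le> x \<and> x \<le> q \<and> q \<le> b \<and> p < q \<and> q - p < d \<and> R p q"
    and bound: "\<And>D. packing a b D \<Longrightarrow> (\<forall>(p, q)\<in>D. R p q) \<Longrightarrow> (\<Sum>(p, q)\<in>D. q - p) \<le> B"
  shows "\<exists>T. S \<subseteq> T \<and> T \<in> lmeasurable \<and> measure lebesgue T \<le> B"
proof -
  define K where "K = {(p, q). a \<le> p \<and> p < q \<and> q \<le> b \<and> R p q}"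
  \<comment> \<open>The covering theorem is about balls: an interval is the closed ball around its
    midpoint with half its length as radius.\<close>
  define m r :: "real \<times> real \<Rightarrow> real" where "m = (\<lambda>(p, q). (p + q) / 2)" and "r = (\<lambda>(p, q). (q - p) / 2)"
  have cb: "cball (m c) (r c) = {fst c..snd c}" for c
    by (cases c) (auto simp: m_def r_def cball_def dist_real_def abs_if field_simps split: if_splits)
  have rpos: "0 < r c" if "c \<in> K" for c using that by (auto simp: K_def r_def)
  have cov: "\<exists>c. c \<in> K \<and> x \<in> cball (m c) (r c) \<and> r c < d" if "x \<in> S" "0 < d" for x d
  proof -
    obtain p q where "a \<le> p" "p \<le> x" "x \<le> q" "q \<le> b" "p < q" "q - p < d" "R p q"
      using cover[OF \<open>x \<in> S\<close> \<open>0 < d\<close>] by blast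
    then show ?thesis unfolding cb by (intro exI[of _ "(p, q)"]) (auto simp: K_def r_def)
  qed
  obtain C where C: "countable C" "C \<subseteq> K"
     "pairwise (\<lambda>i j. disjnt (cball (m i) (r i)) (cball (m j) (r j))) C"
     "negligible (S - (\<Union>i \<in> C. cball (m i) (r i)))"
    using Vitali_covering_theorem_cballs[OF rpos cov] by blast
  let ?N = "S - (\<Union>i \<in> C. cball (m i) (r i))" and ?U = "\<Union>i \<in> C. cball (m i) (r i)"
  have fin: "measure lebesgue (\<Union>i\<in>I. cball (m i) (r i)) \<le> B" if I: "I \<subseteq> C" "finite I" for I
  proof -
    have "packing a b I"
      unfolding packing_def
    proof (intro conjI)
      show "finite I" by fact
      show "\<forall>(p, q)\<in>I. a \<le> p \<and> p < q \<and> q \<le> b"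
        using I C(2) by (auto simp: K_def)
      show "pairwise (\<lambda>(p, q) (p', q'). q \<le> p' \<or> q' \<le> p) I"
      proof (rule pairwiseI, clarify)
        fix p q p' q' assume *: "(p, q) \<in> I" "(p', q') \<in> I" "\<not> q' \<le> p" "\<not> (p = p' \<and> q = q')"
        then have "disjnt {p..q} {p'..q'}"
          using pairwiseD[OF C(3), of "(p, q)" "(p', q')"] I(1) unfolding cb by auto
        moreover have "p < q" "p' < q'" using * I(1) C(2) by (auto simp: K_def)
        ultimately show "q \<le> p'" using *(3)
          unfolding disjnt_iff by (metis atLeastAtMost_iff le_cases less_imp_le not_le)
      qed
    qed
    then have "(\<Sum>(p, q)\<in>I. q - p) \<le> B"
      using I(1) C(2) by (intro bound) (auto simp: K_def)
    moreover have "measure lebesgue (\<Union>i\<in>I. cball (m i) (r i)) \<le> (\<Sum>i\<in>I. measure lebesgue (cball (m i) (r i)))"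
      by (rule measure_UNION_le) (use I in auto)
    moreover have "(\<Sum>i\<in>I. measure lebesgue (cball (m i) (r i))) = (\<Sum>(p, q)\<in>I. q - p)"
      unfolding cb using I(1) C(2)
      by (intro sum.cong) (auto simp: K_def)
    ultimately show ?thesis by linarith
  qed
  have U: "?U \<in> lmeasurable" "measure lebesgue ?U \<le> B"
    by (rule fmeasurable_UN_bound[OF C(1) _ fin] measure_UN_bound[OF C(1) _ fin]; simp)+
  have N: "?N \<in> lmeasurable" "measure lebesgue ?N = 0"
    using C(4) by (simp_all add: negligible_imp_measurable negligible_imp_measure0)
  have "measure lebesgue (?U \<union> ?N) \<le> measure lebesgue ?U + measure lebesgue ?N"
    using U(1) N(1) by (intro measure_Un_le) auto
  then show ?thesis
    using U N fmeasurable.Un[OF U(1) N(1)] by (intro exI[of _ "?U \<union> ?N"]) simp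
qed

text \<open>The chord joins \<open>x\<close> to a nearby \<open>y\<close> on either side; its slope
  is symmetric in the end points, so these can be put in increasing order.\<close>

lemma frequently_slope_chord:
  fixes f :: "real \<Rightarrow> real"
  assumes "\<exists>\<^sub>F y in at x. Q ((f y - f x) / (y - x))" "p < x" "x < q" "0 < d"
  shows "\<exists>u v. p \<le> u \<and> u \<le> x \<and> x \<le> v \<and> v \<le> q \<and> u < v \<and> v - u < d \<and> Q ((f v - f u) / (v - u))"
proof -
  have "\<forall>\<^sub>F y in at x. y \<in> {p<..<q} \<and> dist y x < d \<and> y \<noteq> x"
    using assms(2-4)
    by (intro eventually_conj eventually_at_in_open' eventually_neq_at_within)
      (auto simp: eventually_at)
  from frequently_eventually_conj[OF assms(1) this]
  obtain y where y: "y \<in> {p<..<q}" "dist y x < d" "Q ((f y - f x) / (y - x))" "y \<noteq> x"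
    using frequently_ex by blast
  show ?thesis
  proof (cases "x < y")
    case True
    then show ?thesis using y assms(2,3)
      by (intro exI[of _ x] exI[of _ y]) (auto simp: dist_real_def)
  next
    case False
    have "(f x - f y) / (x - y) = (f y - f x) / (y - x)"
      by (metis minus_diff_eq minus_divide_divide)
    then show ?thesis using False y assms(2,3)
      by (intro exI[of _ y] exI[of _ x]) (auto simp: dist_real_def)
  qed
qed

text \<open>Thresholds on both sides of zero are what Austin's comparison of signs needs: in a piece
  where \<open>f\<close> rises a falling chord is available, and conversely.\<close>

lemma negligible_oscillating_slope:
  fixes f :: "real \<Rightarrow> real"
  assumes bound: "\<And>D. packing a b D \<Longrightarrow> (\<Sum>(p, q)\<in>D. \<bar>f q - f p\<bar>) \<le> B"
    and "0 < \<alpha>"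
  shows "negligible {x \<in> {a<..<b}. (\<exists>\<^sub>F y in at x. (f y - f x) / (y - x) > \<alpha>) \<and>
      (\<exists>\<^sub>F y in at x. (f y - f x) / (y - x) < - \<alpha>)}" (is "negligible ?S")
proof (cases "a < b")
  case True
  define P where "P = (\<lambda>D. \<Sum>(p, q)\<in>D. \<bar>f q - f p\<bar>)"
  define V where "V = Sup (P ` {D. packing a b D})"
  have bdd: "bdd_above (P ` {D. packing a b D})"
    using bound unfolding P_def by (intro bdd_aboveI2) auto
  have V: "P D \<le> V" if "packing a b D" for D
    unfolding V_def using that bdd by (intro cSup_upper) auto
  have ne: "P ` {D. packing a b D} \<noteq> {}"
    using packing_empty by blast
  show ?thesis
    unfolding negligible_outer_le
  proof (intro allI impI)
    fix e :: real assume e: "0 < e"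
    have "V - e * \<alpha> < V" using e \<open>0 < \<alpha>\<close> by simp
    then obtain D0 where D0: "packing a b D0" "V - e * \<alpha> < P D0"
      using less_cSup_iff[OF ne bdd] unfolding V_def[symmetric] by auto
    \<comment> \<open>Completing \<open>D0\<close> does not lower the variation, and now every point
      of [a,b] lies in some piece.\<close>
    obtain E where E: "D0 \<subseteq> E" "packing a b E" "{a..b} \<subseteq> (\<Union>(p, q)\<in>E. {p..q})"
      using packing_extend[OF D0(1)] True by auto
    have "P D0 \<le> P E"
      unfolding P_def using E packing_finite[OF E(2)] by (intro sum_mono2) auto
    then have PE: "V - e * \<alpha> < P E" using D0 by simp
    \<comment> \<open>The finitely many end points are set aside: any other point is interior to its
      piece, so chords can be chosen inside that piece.\<close>
    define X where "X = fst ` E \<union> snd ` E"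
    have X: "negligible X" "X \<in> lmeasurable" "measure lebesgue X = 0"
      using packing_finite[OF E(2)]
      by (auto simp: X_def negligible_finite intro!: negligible_imp_measurable negligible_imp_measure0)
    \<comment> \<open>Admissible chords: steep, contained in a piece of \<open>E\<close>, and
      directed against the change of \<open>f\<close> over it.\<close>
    define R where "R = (\<lambda>u v. \<alpha> * (v - u) \<le> \<bar>f v - f u\<bar> \<and> (\<exists>p q. (p, q) \<in> E \<and> p \<le> u \<and> v \<le> q \<and>
      (0 \<le> f q - f p \<and> f v - f u \<le> 0 \<or> f q - f p < 0 \<and> 0 \<le> f v - f u)))"
    have "\<exists>T. ?S - X \<subseteq> T \<and> T \<in> lmeasurable \<and> measure lebesgue T \<le> e"
    proof (rule Vitali_packing)
      fix x d :: real assume x: "x \<in> ?S - X" and d: "0 < d"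
      then have "x \<in> (\<Union>(p, q)\<in>E. {p..q})" using E(3) by (auto simp: subset_iff)
      then obtain p q where pq: "(p, q) \<in> E" "p \<le> x" "x \<le> q" by auto
      with x have pxq: "p < x" "x < q" unfolding X_def by (force simp: less_le image_iff)+
      have ab: "a \<le> p" "q \<le> b" using packing_bounds[OF E(2) pq(1)] by auto
      show "\<exists>u v. a \<le> u \<and> u \<le> x \<and> x \<le> v \<and> v \<le> b \<and> u < v \<and> v - u < d \<and> R u v"
      proof (cases "0 \<le> f q - f p")
        case True
        obtain u v where uv: "p \<le> u" "u \<le> x" "x \<le> v" "v \<le> q" "u < v" "v - u < d"
          "(f v - f u) / (v - u) < - \<alpha>"
          using frequently_slope_chord[OF _ pxq d, of "\<lambda>s. s < - \<alpha>" f] x by blast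
        then have "f v - f u < - \<alpha> * (v - u)" by (simp add: pos_divide_less_eq)
        moreover have "0 < \<alpha> * (v - u)" using \<open>0 < \<alpha>\<close> uv by simp
        ultimately have "R u v" unfolding R_def using True pq(1) uv by force
        then show ?thesis using uv ab by (intro exI[of _ u] exI[of _ v]) auto
      next
        case False
        obtain u v where uv: "p \<le> u" "u \<le> x" "x \<le> v" "v \<le> q" "u < v" "v - u < d"
          "(f v - f u) / (v - u) > \<alpha>"
          using frequently_slope_chord[OF _ pxq d, of "\<lambda>s. s > \<alpha>" f] x by blast
        then have "f v - f u > \<alpha> * (v - u)" by (simp add: pos_less_divide_eq)
        moreover have "0 < \<alpha> * (v - u)" using \<open>0 < \<alpha>\<close> uv by simp
        ultimately have "R u v" unfolding R_def using False pq(1) uv by force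
        then show ?thesis using uv ab by (intro exI[of _ u] exI[of _ v]) auto
      qed
    next
      fix D assume D: "packing a b D" and R: "\<forall>(p, q)\<in>D. R p q"
      \<comment> \<open>Near-maximality of \<open>E\<close> turns this into
        \<open>2 * P D < e * \<alpha>\<close>, while steepness gives \<alpha> times the total length
        as a lower bound for \<open>P D\<close>.\<close>
      have "P E + 2 * P D \<le> V"
        unfolding P_def
      proof (rule packing_sum_variation_refine[OF _ E(2) D])
        show "(\<Sum>(p, q)\<in>D. \<bar>f q - f p\<bar>) \<le> V" if "packing a b D" for D
          using V[OF that] by (simp add: P_def)
      qed (use R in \<open>auto simp: R_def\<close>)
      moreover have "\<alpha> * (\<Sum>(p, q)\<in>D. q - p) \<le> P D"
        unfolding P_def sum_distrib_left using R by (intro sum_mono) (auto simp: R_def)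
      moreover have "0 \<le> P D" unfolding P_def by (intro sum_nonneg) auto
      ultimately have "\<alpha> * (\<Sum>(p, q)\<in>D. q - p) \<le> \<alpha> * e" using PE by (simp add: mult.commute)
      then show "(\<Sum>(p, q)\<in>D. q - p) \<le> e" using \<open>0 < \<alpha>\<close> by simp
    qed
    then obtain T where T: "?S - X \<subseteq> T" "T \<in> lmeasurable" "measure lebesgue T \<le> e" by blast
    have "measure lebesgue (T \<union> X) \<le> measure lebesgue T + measure lebesgue X"
      using T X by (intro measure_Un_le) auto
    then show "\<exists>T. ?S \<subseteq> T \<and> T \<in> lmeasurable \<and> measure lebesgue T \<le> e"
      using T X by (intro exI[of _ "T \<union> X"]) (auto intro: fmeasurable.Un)
  qed
next
  case False
  then have "{a<..<b} = {}" by simp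
  then show ?thesis by simp
qed

text \<open>A Chebyshev estimate: disjoint chords of slope at least \<open>M\<close> in absolute
  value have total length at most \<open>B / M\<close>.\<close>

lemma negligible_unbounded_slope:
  fixes f :: "real \<Rightarrow> real"
  assumes bound: "\<And>D. packing a b D \<Longrightarrow> (\<Sum>(p, q)\<in>D. \<bar>f q - f p\<bar>) \<le> B"
  shows "negligible {x \<in> {a<..<b}. \<forall>M. \<exists>\<^sub>F y in at x. \<bar>(f y - f x) / (y - x)\<bar> > M}" (is "negligible ?S")
  unfolding negligible_outer_le
proof (intro allI impI)
  fix e :: real assume e: "0 < e"
  have "0 \<le> B" using bound[OF packing_empty] by simp
  \<comment> \<open>Chosen so that \<open>B \<le> M * e\<close>; the added 1 keeps \<open>M\<close>
    positive when \<open>B = 0\<close>.\<close>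
  define M where "M = (B + 1) / e"
  have M: "0 < M" using e \<open>0 \<le> B\<close> by (simp add: M_def)
  show "\<exists>T. ?S \<subseteq> T \<and> T \<in> lmeasurable \<and> measure lebesgue T \<le> e"
  proof (rule Vitali_packing[where R = "\<lambda>u v. M * (v - u) \<le> \<bar>f v - f u\<bar>"])
    fix x d :: real assume x: "x \<in> ?S" and d: "0 < d"
    then obtain u v where uv: "a \<le> u" "u \<le> x" "x \<le> v" "v \<le> b" "u < v" "v - u < d"
      "\<bar>(f v - f u) / (v - u)\<bar> > M"
      using frequently_slope_chord[of "\<lambda>s. \<bar>s\<bar> > M" f x a b d] by auto
    then have "M * (v - u) \<le> \<bar>f v - f u\<bar>" by (simp add: abs_divide pos_less_divide_eq)
    then show "\<exists>u v. a \<le> u \<and> u \<le> x \<and> x \<le> v \<and> v \<le> b \<and> u < v \<and> v - u < d \<and> M * (v - u) \<le> \<bar>f v - f u\<bar>"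
      using uv by blast
  next
    fix D assume D: "packing a b D" and R: "\<forall>(p, q)\<in>D. M * (q - p) \<le> \<bar>f q - f p\<bar>"
    have "M * (\<Sum>(p, q)\<in>D. q - p) \<le> (\<Sum>(p, q)\<in>D. \<bar>f q - f p\<bar>)"
      unfolding sum_distrib_left using R by (intro sum_mono) auto
    also have "\<dots> \<le> B" by (rule bound[OF D])
    also have "\<dots> \<le> M * e" using e by (simp add: M_def)
    finally show "(\<Sum>(p, q)\<in>D. q - p) \<le> e" using M by simp
  qed
qed

text \<open>If the lower and upper limits differed, two rationals would fit strictly between them
  and \<open>g\<close> would oscillate across both; boundedness makes the common value finite.
  Rational thresholds leave only countably many exceptional sets in the application.\<close>

lemma tendsto_real_if_not_oscillating:
  fixes g :: "'b \<Rightarrow> real"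
  assumes "F \<noteq> bot"
    and osc: "\<And>p q. p \<in> \<rat> \<Longrightarrow> q \<in> \<rat> \<Longrightarrow> p < q \<Longrightarrow> \<not> ((\<exists>\<^sub>F y in F. g y > q) \<and> (\<exists>\<^sub>F y in F. g y < p))"
    and bdd: "\<exists>M. \<not> (\<exists>\<^sub>F y in F. \<bar>g y\<bar> > M)"
  shows "\<exists>L. (g \<longlongrightarrow> L) F"
proof -
  define l u where "l = Liminf F (\<lambda>y. ereal (g y))" and "u = Limsup F (\<lambda>y. ereal (g y))"
  have "l \<le> u" unfolding l_def u_def by (rule Liminf_le_Limsup[OF assms(1)])
  have "l = u"
  proof (rule ccontr)
    assume "l \<noteq> u"
    with \<open>l \<le> u\<close> have "l < u" by simp
    then obtain r s where rs: "l < ereal r" "ereal r < ereal s" "ereal s < u"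
      by (metis ereal_dense2)
    then obtain p q where pq: "p \<in> \<rat>" "q \<in> \<rat>" "r < p" "p < q" "q < s"
      by (metis Rats_dense_in_real less_ereal.simps(1))
    have "\<exists>\<^sub>F y in F. g y < p"
    proof (rule ccontr)
      assume "\<not> ?thesis"
      then have "\<forall>\<^sub>F y in F. ereal p \<le> ereal (g y)" by (simp add: not_frequently not_less)
      then have "ereal p \<le> l" unfolding l_def by (rule Liminf_bounded)
      then show False using rs(1) pq(3) by (metis less_ereal.simps(1) less_trans not_le)
    qed
    moreover have "\<exists>\<^sub>F y in F. g y > q"
    proof (rule ccontr)
      assume "\<not> ?thesis"
      then have "\<forall>\<^sub>F y in F. ereal (g y) \<le> ereal q" by (simp add: not_frequently not_less)
      then have "u \<le> ereal q" unfolding u_def by (rule Limsup_bounded)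
      then show False using rs(3) pq(5) by (metis less_ereal.simps(1) less_trans not_le)
    qed
    ultimately show False using osc[OF pq(1,2,4)] by blast
  qed
  obtain M where "\<forall>\<^sub>F y in F. \<bar>g y\<bar> \<le> M" using bdd by (auto simp: not_frequently not_less)
  then have "\<forall>\<^sub>F y in F. ereal (- M) \<le> ereal (g y)" "\<forall>\<^sub>F y in F. ereal (g y) \<le> ereal M"
    by (auto elim!: eventually_mono)
  then have "ereal (- M) \<le> l" "u \<le> ereal M"
    unfolding l_def u_def by (auto intro: Liminf_bounded Limsup_bounded)
  then obtain L where L: "l = ereal L" using \<open>l = u\<close> by (cases l) auto
  then have "((\<lambda>y. ereal (g y)) \<longlongrightarrow> ereal L) F"
    unfolding tendsto_iff_Liminf_eq_Limsup[OF assms(1)] using \<open>l = u\<close> by (simp add: l_def u_def)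
  then show ?thesis by auto
qed

text \<open>Where the difference quotient fails to converge it is either unbounded
  (\<open>U\<close>) or oscillates across some rationals \<open>p < q\<close>
  (\<open>S (p, q)\<close>). These are countably many null sets.\<close>

lemma negligible_not_differentiable_packing:
  fixes f :: "real \<Rightarrow> real"
  assumes bound: "\<And>D. packing a b D \<Longrightarrow> (\<Sum>(p, q)\<in>D. \<bar>f q - f p\<bar>) \<le> B" and "a \<le> b"
  shows "negligible {x \<in> {a<..<b}. \<not> f differentiable (at x)}"
proof -
  define S where "S = (\<lambda>(p, q). {x \<in> {a<..<b}. p < q \<and> (\<exists>\<^sub>F y in at x. (f y - f x) / (y - x) > q) \<and>
      (\<exists>\<^sub>F y in at x. (f y - f x) / (y - x) < p)})"
  define U where "U = {x \<in> {a<..<b}. \<forall>M. \<exists>\<^sub>F y in at x. \<bar>(f y - f x) / (y - x)\<bar> > M}"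
  have nS: "negligible (S (p, q))" if pq: "p < q" for p q
  proof -
    \<comment> \<open>Subtracting the line with the mean slope moves the thresholds \<open>q\<close>
      and \<open>p\<close> to plus and minus \<open>(q - p) / 2\<close>, at the cost of adding at
      most \<open>\<bar>c\<bar> * (b - a)\<close> to the variation bound.\<close>
    define c h where "c = (p + q) / 2" and "h = (\<lambda>t. f t - c * t)"
    have hb: "(\<Sum>(p, q)\<in>D. \<bar>h q - h p\<bar>) \<le> B + \<bar>c\<bar> * (b - a)" if D: "packing a b D" for D
    proof -
      have "(\<Sum>(p, q)\<in>D. \<bar>h q - h p\<bar>) \<le> (\<Sum>(p, q)\<in>D. \<bar>f q - f p\<bar> + \<bar>c\<bar> * (q - p))"
      proof (intro sum_mono, clarify)
        fix p q assume "(p, q) \<in> D"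
        then have "p < q" using packing_bounds[OF D] by blast
        have "\<bar>h q - h p\<bar> = \<bar>(f q - f p) - c * (q - p)\<bar>" by (simp add: h_def algebra_simps)
        also have "\<dots> \<le> \<bar>f q - f p\<bar> + \<bar>c * (q - p)\<bar>" by (rule abs_triangle_ineq4)
        finally show "\<bar>h q - h p\<bar> \<le> \<bar>f q - f p\<bar> + \<bar>c\<bar> * (q - p)"
          using \<open>p < q\<close> by (simp add: abs_mult)
      qed
      also have "\<dots> = (\<Sum>(p, q)\<in>D. \<bar>f q - f p\<bar>) + \<bar>c\<bar> * (\<Sum>(p, q)\<in>D. q - p)"
        by (simp add: sum.distrib sum_distrib_left case_prod_unfold)
      also have "\<dots> \<le> B + \<bar>c\<bar> * (b - a)"
        by (intro add_mono bound D mult_left_mono packing_sum_length_le assms) simp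
      finally show ?thesis .
    qed
    have "negligible {x \<in> {a<..<b}. (\<exists>\<^sub>F y in at x. (h y - h x) / (y - x) > (q - p) / 2) \<and>
      (\<exists>\<^sub>F y in at x. (h y - h x) / (y - x) < - ((q - p) / 2))}"
      by (rule negligible_oscillating_slope[OF hb]) (use pq in simp_all)
    moreover have "S (p, q) \<subseteq> {x \<in> {a<..<b}. (\<exists>\<^sub>F y in at x. (h y - h x) / (y - x) > (q - p) / 2) \<and>
      (\<exists>\<^sub>F y in at x. (h y - h x) / (y - x) < - ((q - p) / 2))}"
    proof -
      \<comment> \<open>At \<open>y = x\<close> both quotients are 0 by division by zero, so the
        shift by \<open>c\<close> can fail there; the filter \<open>at x\<close> excludes that
        point.\<close>
      have slope: "(h y - h x) / (y - x) = (f y - f x) / (y - x) - c" if "y \<noteq> x" for x y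
        using that by (simp add: h_def divide_simps) (simp add: algebra_simps)
      have shift: "(q - p) / 2 < s - c \<longleftrightarrow> q < s" "s - c < - ((q - p) / 2) \<longleftrightarrow> s < p" for s
        unfolding c_def by (auto simp: field_simps)
      have "\<exists>\<^sub>F y in at x. (h y - h x) / (y - x) > (q - p) / 2"
        if "\<exists>\<^sub>F y in at x. (f y - f x) / (y - x) > q" for x
        using frequently_eventually_conj[OF that eventually_neq_at_within[of x x UNIV]]
        by (rule frequently_elim1) (metis slope shift(1))
      moreover have "\<exists>\<^sub>F y in at x. (h y - h x) / (y - x) < - ((q - p) / 2)"
        if "\<exists>\<^sub>F y in at x. (f y - f x) / (y - x) < p" for x
        using frequently_eventually_conj[OF that eventually_neq_at_within[of x x UNIV]]
        by (rule frequently_elim1) (metis slope shift(2))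
      ultimately show ?thesis unfolding S_def by blast
    qed
    ultimately show ?thesis by (rule negligible_subset)
  qed
  have "S (p, q) = {}" if "\<not> p < q" for p q using that by (simp add: S_def)
  then have nS': "negligible (S k)" for k using nS by (cases k) (metis negligible_empty)
  have "negligible (U \<union> (\<Union>k\<in>\<rat> \<times> \<rat>. S k))"
    unfolding U_def
    by (intro negligible_Un negligible_unbounded_slope[OF bound] negligible_countable_Union
        countable_image countable_SIGMA countable_rat)
      (use nS' in auto)
  moreover have "{x \<in> {a<..<b}. \<not> f differentiable (at x)} \<subseteq> U \<union> (\<Union>k\<in>\<rat> \<times> \<rat>. S k)"
  proof (rule subsetI, rule ccontr)
    fix x assume x: "x \<in> {x \<in> {a<..<b}. \<not> f differentiable (at x)}" "x \<notin> U \<union> (\<Union>k\<in>\<rat> \<times> \<rat>. S k)"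
    have "\<exists>L. ((\<lambda>y. (f y - f x) / (y - x)) \<longlongrightarrow> L) (at x)"
    proof (rule tendsto_real_if_not_oscillating)
      show "\<exists>M. \<not> (\<exists>\<^sub>F y in at x. M < \<bar>(f y - f x) / (y - x)\<bar>)"
        using x unfolding U_def by auto
      fix p q :: real assume pq: "p \<in> \<rat>" "q \<in> \<rat>" "p < q"
      then have "x \<notin> S (p, q)" using x(2) by auto
      then show "\<not> ((\<exists>\<^sub>F y in at x. (f y - f x) / (y - x) > q) \<and> (\<exists>\<^sub>F y in at x. (f y - f x) / (y - x) < p))"
        using x(1) pq(3) by (auto simp: S_def)
    qed simp
    then obtain L where "(f has_field_derivative L) (at x)"
      unfolding has_field_derivative_iff by blast
    then show False using x(1) by (auto simp: differentiable_def has_field_derivative_def)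
  qed
  ultimately show ?thesis by (rule negligible_subset)
qed

section \<open>Absolute continuity in terms of packings, and differentiability almost
  everywhere\<close>

lemma abs_continuous_onE:
  assumes "abs_continuous_on a b f" "0 < e"
  obtains d where "0 < d" "\<And>(n::nat) p q. (\<forall>i<n. a \<le> p i \<and> p i \<le> q i \<and> q i \<le> b) \<Longrightarrow>
        disjoint_family_on (\<lambda>i. {p i<..<q i}) {..<n} \<Longrightarrow>
        (\<Sum>i<n. q i - p i) < d \<Longrightarrow> (\<Sum>i<n. norm (f (q i) - f (p i))) < e"
proof -
  from assms(1)[unfolded abs_continuous_on_def, rule_format, OF assms(2)]
  show thesis by (elim exE conjE, intro that) blast+
qed

text \<open>Passes from indexed families to sets of pairs by enumerating the packing.\<close>

lemma abs_continuous_on_packing: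
  assumes "abs_continuous_on a b f" "0 < e"
  shows "\<exists>d>0. \<forall>D. packing a b D \<longrightarrow> (\<Sum>(p, q)\<in>D. q - p) < d \<longrightarrow> (\<Sum>(p, q)\<in>D. norm (f q - f p)) < e"
proof -
  obtain d where d: "0 < d" "\<And>(n::nat) p q. (\<forall>i<n. a \<le> p i \<and> p i \<le> q i \<and> q i \<le> b) \<Longrightarrow>
        disjoint_family_on (\<lambda>i. {p i<..<q i}) {..<n} \<Longrightarrow>
        (\<Sum>i<n. q i - p i) < d \<Longrightarrow> (\<Sum>i<n. norm (f (q i) - f (p i))) < e"
    using abs_continuous_onE[OF assms] by blast
  show ?thesis
  proof (intro exI[of _ d] conjI allI impI d(1))
    fix D assume D: "packing a b D" and len: "(\<Sum>(p, q)\<in>D. q - p) < d"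
    obtain h where h: "bij_betw h {..<card D} D"
      using ex_bij_betw_nat_finite[OF packing_finite[OF D]] by (auto simp: atLeast0LessThan)
    have hD: "(fst (h i), snd (h i)) \<in> D" if "i < card D" for i
      using h that by (auto simp: bij_betw_def)
    have sums: "(\<Sum>i<card D. g (h i)) = sum g D" for g :: "real \<times> real \<Rightarrow> real"
      by (rule sum.reindex_bij_betw[OF h])
    have "(\<Sum>i<card D. norm (f (snd (h i)) - f (fst (h i)))) < e"
    proof (rule d(2))
      show "\<forall>i<card D. a \<le> fst (h i) \<and> fst (h i) \<le> snd (h i) \<and> snd (h i) \<le> b"
        using packing_bounds[OF D hD] by (auto intro: less_imp_le)
      show "(\<Sum>i<card D. snd (h i) - fst (h i)) < d"
        using len sums[of "\<lambda>k. snd k - fst k"] by (simp add: case_prod_unfold)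
      show "disjoint_family_on (\<lambda>i. {fst (h i)<..<snd (h i)}) {..<card D}"
        unfolding disjoint_family_on_def
      proof (intro ballI impI)
        fix i j assume ij: "i \<in> {..<card D}" "j \<in> {..<card D}" "i \<noteq> j"
        then have "h i \<noteq> h j" using h by (auto simp: bij_betw_def inj_on_def)
        then have "snd (h i) \<le> fst (h j) \<or> snd (h j) \<le> fst (h i)"
          using packing_disjoint[OF D hD hD] ij by (auto simp: prod_eq_iff)
        then show "{fst (h i)<..<snd (h i)} \<inter> {fst (h j)<..<snd (h j)} = {}" by auto
      qed
    qed
    then show "(\<Sum>(p, q)\<in>D. norm (f q - f p)) < e"
      using sums[of "\<lambda>k. norm (f (snd k) - f (fst k))"] by (simp add: case_prod_unfold)
  qed
qed

lemma abs_continuous_on_subinterval: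
  assumes "abs_continuous_on a b f" "a \<le> a'" "b' \<le> b"
  shows "abs_continuous_on a' b' f"
  unfolding abs_continuous_on_def
proof (intro allI impI)
  fix e :: real assume "0 < e"
  obtain d where d: "0 < d" "\<And>(n::nat) p q. (\<forall>i<n. a \<le> p i \<and> p i \<le> q i \<and> q i \<le> b) \<Longrightarrow>
        disjoint_family_on (\<lambda>i. {p i<..<q i}) {..<n} \<Longrightarrow>
        (\<Sum>i<n. q i - p i) < d \<Longrightarrow> (\<Sum>i<n. norm (f (q i) - f (p i))) < e"
    using abs_continuous_onE[OF assms(1) \<open>0 < e\<close>] by blast
  show "\<exists>\<delta>>0. \<forall>(n::nat) p q. (\<forall>i<n. a' \<le> p i \<and> p i \<le> q i \<and> q i \<le> b') \<and>
        disjoint_family_on (\<lambda>i. {p i<..<q i}) {..<n} \<and> (\<Sum>i<n. q i - p i) < \<delta> \<longrightarrow>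
        (\<Sum>i<n. norm (f (q i) - f (p i))) < e"
    using d assms(2,3) by (intro exI[of _ d]) (auto intro!: d(2) intro: order_trans)
qed

lemma abs_continuous_on_inner_Basis:
  fixes f :: "real \<Rightarrow> 'a::euclidean_space"
  assumes "abs_continuous_on a b f" "i \<in> Basis"
  shows "abs_continuous_on a b (\<lambda>t. f t \<bullet> i)"
  unfolding abs_continuous_on_def
proof (intro allI impI)
  fix e :: real assume "0 < e"
  obtain d where d: "0 < d" "\<And>(n::nat) p q. (\<forall>i<n. a \<le> p i \<and> p i \<le> q i \<and> q i \<le> b) \<Longrightarrow>
        disjoint_family_on (\<lambda>i. {p i<..<q i}) {..<n} \<Longrightarrow>
        (\<Sum>i<n. q i - p i) < d \<Longrightarrow> (\<Sum>i<n. norm (f (q i) - f (p i))) < e"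
    using abs_continuous_onE[OF assms(1) \<open>0 < e\<close>] by blast
  have "(\<Sum>j<n. norm (f (q j) \<bullet> i - f (p j) \<bullet> i)) \<le> (\<Sum>j<n. norm (f (q j) - f (p j)))"
    for n :: nat and p q
    by (intro sum_mono) (use Basis_le_norm[OF assms(2)] in \<open>simp add: inner_diff_left[symmetric]\<close>)
  then show "\<exists>\<delta>>0. \<forall>(n::nat) p q. (\<forall>i<n. a \<le> p i \<and> p i \<le> q i \<and> q i \<le> b) \<and>
        disjoint_family_on (\<lambda>i. {p i<..<q i}) {..<n} \<and> (\<Sum>i<n. q i - p i) < \<delta> \<longrightarrow>
        (\<Sum>j<n. norm (f (q j) \<bullet> i - f (p j) \<bullet> i)) < e"
    using d by (intro exI[of _ d]) (blast intro: le_less_trans)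
qed

text \<open>With \<epsilon> = 1, absolute continuity bounds the variation by 1 on every subinterval
  shorter than \<open>d\<close>, so the bounded variation result applies there. Countably many such
  subintervals with rational end points cover the open interval.\<close>

lemma abs_continuous_on_AE_differentiable_real:
  fixes f :: "real \<Rightarrow> real"
  assumes "abs_continuous_on a b f"
  shows "negligible {x \<in> {a<..<b}. \<not> f differentiable (at x)}"
proof -
  obtain d where d: "0 < d"
    "\<forall>D. packing a b D \<longrightarrow> (\<Sum>(p, q)\<in>D. q - p) < d \<longrightarrow> (\<Sum>(p, q)\<in>D. norm (f q - f p)) < 1"
    using abs_continuous_on_packing[OF assms, of 1] by auto
  define K where "K = {(p, q) \<in> \<rat> \<times> \<rat>. a \<le> p \<and> p < q \<and> q \<le> b \<and> q - p < d}"
  have "countable K"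
    by (rule countable_subset[of _ "\<rat> \<times> \<rat>"]) (auto simp: K_def countable_rat)
  have N: "negligible {x \<in> {p<..<q}. \<not> f differentiable (at x)}" if "(p, q) \<in> K" for p q
  proof (rule negligible_not_differentiable_packing)
    have pq: "a \<le> p" "p < q" "q \<le> b" "q - p < d" using that by (auto simp: K_def)
    show "p \<le> q" using pq by simp
    fix D assume D: "packing p q D"
    then have D': "packing a b D" using pq(1,3) unfolding packing_def by force
    have "(\<Sum>(p, q)\<in>D. q - p) < d" using packing_sum_length_le[OF D] pq by simp
    then show "(\<Sum>(p, q)\<in>D. \<bar>f q - f p\<bar>) \<le> 1" using d(2) D' by (auto intro: less_imp_le)
  qed
  have "negligible (\<Union>k\<in>K. {x \<in> {fst k<..<snd k}. \<not> f differentiable (at x)})"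
    by (intro negligible_countable_Union countable_image \<open>countable K\<close>) (use N in \<open>auto simp del: minus_divide_left\<close>)
  moreover have "{x \<in> {a<..<b}. \<not> f differentiable (at x)} \<subseteq>
      (\<Union>k\<in>K. {x \<in> {fst k<..<snd k}. \<not> f differentiable (at x)})"
  proof
    fix x assume x: "x \<in> {x \<in> {a<..<b}. \<not> f differentiable (at x)}"
    \<comment> \<open>Both rationals are taken within \<open>d / 2\<close> of \<open>x\<close>, so
      that \<open>q - p < d\<close>.\<close>
    have "max a (x - d / 2) < x" using x d(1) by auto
    then obtain p where p: "p \<in> \<rat>" "max a (x - d / 2) < p" "p < x" using Rats_dense_in_real by blast
    have "x < min b (x + d / 2)" using x d(1) by auto
    then obtain q where q: "q \<in> \<rat>" "x < q" "q < min b (x + d / 2)" using Rats_dense_in_real by blast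
    have "(p, q) \<in> K" using p q by (auto simp: K_def)
    then show "x \<in> (\<Union>k\<in>K. {x \<in> {fst k<..<snd k}. \<not> f differentiable (at x)})"
      using x p q by (intro UN_I[of "(p, q)"]) auto
  qed
  ultimately show ?thesis by (rule negligible_subset)
qed

text \<open>Differentiability is componentwise, and the basis is finite.\<close>

lemma abs_continuous_on_AE_differentiable:
  fixes f :: "real \<Rightarrow> 'a::euclidean_space"
  assumes "abs_continuous_on a b f"
  shows "negligible {x \<in> {a<..<b}. \<not> f differentiable (at x)}"
proof -
  have "negligible (\<Union>i\<in>Basis. {x \<in> {a<..<b}. \<not> (\<lambda>t. f t \<bullet> i) differentiable (at x)})"
    using abs_continuous_on_AE_differentiable_real[OF abs_continuous_on_inner_Basis[OF assms]]
    by (intro negligible_Union) auto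
  then show ?thesis
    by (rule negligible_subset) (auto simp: differentiable_componentwise_within[of f])
qed

section \<open>Absolutely continuous functions with vanishing derivative\<close>

lemma negligible_outer_open:
  fixes N :: "'a::euclidean_space set"
  assumes "negligible N" "0 < d"
  obtains U where "open U" "N \<subseteq> U" "U \<in> lmeasurable" "measure lebesgue U < d"
proof -
  have N: "N \<in> lmeasurable" "measure lebesgue N = 0"
    using assms(1) by (simp_all add: negligible_imp_measurable negligible_imp_measure0)
  obtain U where U: "open U" "N \<subseteq> U" "U - N \<in> lmeasurable" "emeasure lebesgue (U - N) < ennreal d"
    using sets_lebesgue_outer_open[of N d] N(1) assms(2) by (auto simp: fmeasurableD)
  have U_eq: "U = N \<union> (U - N)" using U(2) by blast
  have "U \<in> lmeasurable" by (subst U_eq) (rule fmeasurable.Un[OF N(1) U(3)])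
  moreover have "measure lebesgue (N \<union> (U - N)) \<le> measure lebesgue N + measure lebesgue (U - N)"
    using N(1) U(3) by (intro measure_Un_le) auto
  moreover have "measure lebesgue (U - N) < d"
    using U(3,4) assms(2) by (simp add: emeasure_eq_measure2 ennreal_less_iff)
  ultimately show ?thesis
    using that[of U] U(1,2) N(2) U_eq by simp
qed

text \<open>Choose a gauge and a fine tagged division. Pieces tagged outside \<open>N\<close>
  contribute at most \<open>e / 2\<close> because the derivative vanishes at the tag; those tagged
  in \<open>N\<close> lie in an open set of measure below \<open>d\<close>, so absolute continuity
  keeps their contribution below \<open>e / 2\<close>.\<close>

lemma abs_continuous_on_zero_derivative_imp_eq:
  fixes f :: "real \<Rightarrow> 'a::real_normed_vector"
  assumes ac: "abs_continuous_on a b f" and "a \<le> b" and N: "negligible N"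
    and der: "\<And>t. t \<in> {a..b} - N \<Longrightarrow> (f has_vector_derivative 0) (at t within {a..b})"
  shows "f b = f a"
proof -
  have "norm (f b - f a) \<le> e" if "0 < e" for e
  proof -
    obtain d where d: "0 < d"
      "\<And>D. packing a b D \<Longrightarrow> (\<Sum>(p, q)\<in>D. q - p) < d \<Longrightarrow> (\<Sum>(p, q)\<in>D. norm (f q - f p)) < e / 2"
      using abs_continuous_on_packing[OF ac, of "e / 2"] \<open>0 < e\<close> by auto
    \<comment> \<open>The slope tolerance for the good pieces; the added 1 avoids division by zero
      when \<open>a = b\<close>.\<close>
    define k where "k = e / (2 * (b - a + 1))"
    have k: "0 < k" "k * (b - a) \<le> e / 2"
      using \<open>0 < e\<close> \<open>a \<le> b\<close> by (auto simp: k_def field_simps)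
    obtain U where U: "open U" "N \<subseteq> U" "U \<in> lmeasurable" "measure lebesgue U < d"
      using negligible_outer_open[OF N d(1)] by blast
    \<comment> \<open>The gauge radius: at points of \<open>N\<close> it stays inside
      \<open>U\<close>, at other points of [a,b] it enforces slope at most \<open>k\<close>;
      elsewhere it is arbitrary.\<close>
    have "\<exists>r>0. (t \<in> N \<longrightarrow> ball t r \<subseteq> U) \<and>
        (t \<in> {a..b} - N \<longrightarrow> (\<forall>y\<in>{a..b}. \<bar>y - t\<bar> < r \<longrightarrow> norm (f y - f t) \<le> k * \<bar>y - t\<bar>))" for t
    proof (cases "t \<in> N")
      case True
      then show ?thesis using U(1,2) open_contains_ball by blast
    next
      case False
      show ?thesis
      proof (cases "t \<in> {a..b}")
        case True
        then have "(f has_derivative (\<lambda>h. 0)) (at t within {a..b})"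
          using der[of t] False by (simp add: has_vector_derivative_def)
        then show ?thesis using False k(1)
          by (auto simp: has_derivative_within_alt)
      qed (use False in \<open>auto intro: exI[of _ 1]\<close>)
    qed
    then obtain r where r: "\<And>t. 0 < r t" "\<And>t. t \<in> N \<Longrightarrow> ball t (r t) \<subseteq> U"
      "\<And>t y. t \<in> {a..b} - N \<Longrightarrow> y \<in> {a..b} \<Longrightarrow> \<bar>y - t\<bar> < r t \<Longrightarrow> norm (f y - f t) \<le> k * \<bar>y - t\<bar>"
      by metis
    have "gauge (\<lambda>t. ball t (r t))" using r(1) by (simp add: gauge_def)
    then obtain P where P: "P tagged_division_of {a..b}" "(\<lambda>t. ball t (r t)) fine P"
      using fine_division_exists_real by blast
    note finP = tagged_division_of_finite[OF P(1)]
    have PK: "K = {Inf K..Sup K} \<and> a \<le> Inf K \<and> Inf K \<le> t \<and> t \<le> Sup K \<and> Sup K \<le> b \<and> K \<subseteq> ball t (r t)"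
      if tK: "(t, K) \<in> P" for t K
    proof -
      obtain u v where K: "K = {u..v}" using tagged_division_ofD(4)[OF P(1) tK] by auto
      have t: "t \<in> K" "K \<subseteq> {a..b}" using tagged_division_ofD(2,3)[OF P(1) tK] by auto
      have "u \<le> v" using t(1) K by auto
      then show ?thesis using t P(2) tK unfolding K fine_def by auto
    qed
    \<comment> \<open>Degenerate pieces are left out of \<open>Q\<close>: they do not fit into a
      packing, and several tags may share one. Their increment is zero, so they count among the good
      pieces.\<close>
    define Q where "Q = {(t, K) \<in> P. t \<in> N \<and> Inf K < Sup K}"
    define D where "D = (\<lambda>(t, K). (Inf K, Sup K)) ` Q"
    have QP: "Q \<subseteq> P" by (auto simp: Q_def)
    have disj: "Sup K \<le> Inf K' \<or> Sup K' \<le> Inf K"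
      if "(t, K) \<in> Q" "(t', K') \<in> Q" "(t, K) \<noteq> (t', K')" for t K t' K'
    proof -
      have "(t, K) \<in> P" "(t', K') \<in> P" using that QP by auto
      then have "interior K \<inter> interior K' = {}"
        using tagged_division_ofD(5)[OF P(1)] that(3) by blast
      moreover have "K = {Inf K..Sup K}" "K' = {Inf K'..Sup K'}"
        using PK \<open>(t, K) \<in> P\<close> \<open>(t', K') \<in> P\<close> by blast+
      ultimately have "{Inf K<..<Sup K} \<inter> {Inf K'<..<Sup K'} = {}"
        by (metis interior_atLeastAtMost_real)
      then have "max (Inf K) (Inf K') \<ge> min (Sup K) (Sup K')"
        by (metis Int_greaterThanLessThan greaterThanLessThan_empty_iff)
      then show ?thesis using that by (auto simp: Q_def max_def min_def split: if_splits)
    qed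
    have inj: "inj_on (\<lambda>(t, K). (Inf K, Sup K)) Q"
    proof (rule inj_onI, clarify)
      fix t K t' K' assume "(t, K) \<in> Q" "(t', K') \<in> Q" "Inf K = Inf K'" "Sup K = Sup K'"
      then show "t = t' \<and> K = K'"
        using disj[of t K t' K'] unfolding Q_def by force
    qed
    have D: "packing a b D"
      unfolding packing_def
    proof (intro conjI)
      show "finite D" using finP QP by (auto simp: D_def intro: finite_subset)
      show "\<forall>(p, q)\<in>D. a \<le> p \<and> p < q \<and> q \<le> b" using PK by (auto simp: D_def Q_def)
      show "pairwise (\<lambda>(p, q) (p', q'). q \<le> p' \<or> q' \<le> p) D"
        using disj unfolding D_def pairwise_def by fastforce
    qed
    \<comment> \<open>Open intervals are used because the closed ones may share end points.\<close>
    have "(\<Sum>(p, q)\<in>D. q - p) = (\<Sum>k\<in>D. measure lebesgue {fst k<..<snd k})"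
      by (intro sum.cong) (auto dest: packing_bounds[OF D])
    also have "\<dots> = measure lebesgue (\<Union>k\<in>D. {fst k<..<snd k})"
    proof (rule measure_UNION'[symmetric])
      show "pairwise (\<lambda>x y. disjnt {fst x<..<snd x} {fst y<..<snd y}) D"
        using packing_disjoint[OF D] unfolding pairwise_def disjnt_iff
        by (smt (verit, best) greaterThanLessThan_iff prod.collapse)
    qed (use packing_finite[OF D] in auto)
    also have "\<dots> \<le> measure lebesgue U"
    proof (rule measure_mono_fmeasurable[OF _ _ U(3)])
      have "{Inf K<..<Sup K} \<subseteq> U" if "(t, K) \<in> Q" for t K
      proof -
        have "(t, K) \<in> P" "t \<in> N" using that by (auto simp: Q_def)
        then have "K \<subseteq> U" "K = {Inf K..Sup K}" using PK r(2) by blast+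
        then show ?thesis by (metis greaterThanLessThan_subseteq_atLeastAtMost_iff order_refl subset_trans)
      qed
      then show "(\<Union>k\<in>D. {fst k<..<snd k}) \<subseteq> U" by (fastforce simp: D_def)
    qed (use packing_finite[OF D] in auto)
    finally have "(\<Sum>(p, q)\<in>D. norm (f q - f p)) < e / 2" using d(2)[OF D] U(4) by linarith
    moreover have "(\<Sum>(p, q)\<in>D. norm (f q - f p)) = (\<Sum>(t, K)\<in>Q. norm (f (Sup K) - f (Inf K)))"
      unfolding D_def by (subst sum.reindex[OF inj]) (simp add: case_prod_unfold)
    ultimately have bad: "(\<Sum>(t, K)\<in>Q. norm (f (Sup K) - f (Inf K))) < e / 2" by simp
    have good: "norm (f (Sup K) - f (Inf K)) \<le> k * (Sup K - Inf K)" if "(t, K) \<in> P - Q" for t K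
    proof (cases "Inf K < Sup K")
      case True
      then have t: "t \<in> {a..b} - N" using that PK[of t K] by (auto simp: Q_def)
      have K: "K = {Inf K..Sup K}" "a \<le> Inf K" "Inf K \<le> t" "t \<le> Sup K" "Sup K \<le> b" "K \<subseteq> ball t (r t)"
        using PK[of t K] that by auto
      have "Inf K \<in> K" "Sup K \<in> K" using K(1) True by (metis atLeastAtMost_iff less_imp_le order_refl)+
      then have "dist t (Inf K) < r t" "dist t (Sup K) < r t" using K(6) by auto
      \<comment> \<open>The tag splits the piece in two, and the derivative estimate applies from
        the tag to each end.\<close>
      then have "norm (f (Inf K) - f t) \<le> k * (t - Inf K)" "norm (f (Sup K) - f t) \<le> k * (Sup K - t)"
        using r(3)[OF t, of "Inf K"] r(3)[OF t, of "Sup K"] K(2-5) by (auto simp: dist_real_def)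
      moreover have "norm (f (Sup K) - f (Inf K)) \<le> norm (f (Sup K) - f t) + norm (f (Inf K) - f t)"
        by (metis norm_triangle_ineq4 diff_diff_eq2 diff_add_cancel)
      ultimately show ?thesis by (simp add: algebra_simps)
    next
      case False
      moreover have "Inf K \<le> Sup K" using PK[of t K] that by auto
      ultimately have "Sup K = Inf K" by simp
      then show ?thesis by simp
    qed
    have "norm (f b - f a) = norm (\<Sum>(t, K)\<in>P. f (Sup K) - f (Inf K))"
      by (simp add: additive_tagged_division_1[OF \<open>a \<le> b\<close> P(1)])
    also have "\<dots> \<le> (\<Sum>(t, K)\<in>P. norm (f (Sup K) - f (Inf K)))"
      by (rule order_trans[OF norm_sum]) (simp add: case_prod_unfold)
    also have "\<dots> = (\<Sum>(t, K)\<in>P - Q. norm (f (Sup K) - f (Inf K))) + (\<Sum>(t, K)\<in>Q. norm (f (Sup K) - f (Inf K)))"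
      by (rule sum.subset_diff[OF QP finP])
    also have "(\<Sum>(t, K)\<in>P - Q. norm (f (Sup K) - f (Inf K))) \<le> (\<Sum>(t, K)\<in>P - Q. k * (Sup K - Inf K))"
      using good by (intro sum_mono) auto
    also have "\<dots> \<le> (\<Sum>(t, K)\<in>P. k * (Sup K - Inf K))"
    proof (rule sum_mono2[OF finP])
      fix c assume "c \<in> P - (P - Q)"
      then show "0 \<le> (case c of (t, K) \<Rightarrow> k * (Sup K - Inf K))"
        using k(1) by (cases c) (auto simp: Q_def)
    qed auto
    also have "\<dots> = k * (b - a)"
      using additive_tagged_division_1[OF \<open>a \<le> b\<close> P(1), of "\<lambda>t. k * t"]
      by (simp add: right_diff_distrib)
    finally show ?thesis using bad k(2) by linarith
  qed
  then have "norm (f b - f a) \<le> 0" by (metis field_le_epsilon add_0)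
  then show ?thesis by simp
qed

section \<open>Straight motion\<close>

text \<open>For a unit vector \<open>u\<close>, the component of \<open>y\<close> orthogonal to
  \<open>u\<close>.\<close>

definition reject :: "'a::real_inner \<Rightarrow> 'a \<Rightarrow> 'a" where
  "reject u y = y - (y \<bullet> u) *\<^sub>R u"

lemma bounded_linear_reject: "bounded_linear (reject u)"
  unfolding reject_def
  by (intro bounded_linear_sub bounded_linear_ident bounded_linear_scaleR_const bounded_linear_inner_left)

lemma reject_eq_0_iff:
  assumes "norm u = 1"
  shows "reject u y = 0 \<longleftrightarrow> (\<exists>c. y = c *\<^sub>R u)"
  using assms by (auto simp: reject_def dot_square_norm)

lemma motion_path_derivative:
  assumes "motion_path x" "t \<in> {0..1}"
  shows "(x has_vector_derivative velocity x t) (at t within {0..1})"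
  using assms by (simp add: motion_path_def velocity_def vector_derivative_works)

text \<open>In a nondegenerate interval every point is a limit point, so the derivative within it is
  unique, also at the ends.\<close>

lemma has_vector_derivative_const_on_imp_zero:
  fixes f :: "real \<Rightarrow> 'a::real_normed_vector"
  assumes "(f has_vector_derivative d) (at t within {a..b})" "a < b" "t \<in> {a..b}"
    and "\<And>s. s \<in> {a..b} \<Longrightarrow> f s = c"
  shows "d = 0"
proof -
  have "((\<lambda>_. c) has_vector_derivative d) (at t within {a..b})"
    using assms by (intro has_vector_derivative_transform[OF assms(3) _ assms(1)]) auto
  moreover have "((\<lambda>_. c) has_vector_derivative 0) (at t within {a..b})"
    by (rule has_vector_derivative_const)
  ultimately show ?thesis
    using assms(2,3) vector_derivative_unique_within
    by (metis islimpt_Icc trivial_limit_within)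
qed

text \<open>Composing with the bounded linear map \<open>reject u\<close> removes the scalar
  functions \<open>s\<close> and \<alpha>, for which no regularity is given, before anything is
  differentiated or integrated.\<close>

lemma straight_iff_direction_time_invariant:
  fixes x :: "real \<Rightarrow> 'a::real_inner"
  assumes "motion_path x"
  shows "straight x \<longleftrightarrow> direction_time_invariant x"
proof
  assume "straight x"
  then obtain u s where u: "norm u = 1" and s: "\<And>t. t \<in> {0..1} \<Longrightarrow> x t = x 0 + s t *\<^sub>R u"
    unfolding straight_def by blast
  have "\<exists>c. velocity x t = c *\<^sub>R u" if t: "t \<in> {0..1}" for t
  proof -
    have d: "((\<lambda>t. reject u (x t)) has_vector_derivative reject u (velocity x t)) (at t within {0..1})"
      by (rule bounded_linear.has_vector_derivative[OF bounded_linear_reject motion_path_derivative[OF assms t]])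
    have c: "reject u (x r) = reject u (x 0)" if "r \<in> {0..1}" for r
      using u by (subst s[OF that]) (simp add: reject_def inner_add_left dot_square_norm algebra_simps)
    have "reject u (velocity x t) = 0"
      by (rule has_vector_derivative_const_on_imp_zero[OF d _ t c]) simp_all
    then show ?thesis using reject_eq_0_iff[OF u] by blast
  qed
  then obtain \<alpha> where "\<forall>t\<in>{0..1}. velocity x t = \<alpha> t *\<^sub>R u" by metis
  then show "direction_time_invariant x" unfolding direction_time_invariant_def using u by blast
next
  assume "direction_time_invariant x"
  then obtain u \<alpha> where u: "norm u = 1" and v: "\<And>t. t \<in> {0..1} \<Longrightarrow> velocity x t = \<alpha> t *\<^sub>R u"
    unfolding direction_time_invariant_def by blast
  have "((\<lambda>t. reject u (x t)) has_vector_derivative 0) (at t within {0..1})" if t: "t \<in> {0..1}" for t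
    using bounded_linear.has_vector_derivative[OF bounded_linear_reject[of u] motion_path_derivative[OF assms t]]
      reject_eq_0_iff[OF u, of "velocity x t"] v[OF t] by auto
  then obtain c where "\<And>t. t \<in> {0..1} \<Longrightarrow> reject u (x t) = c"
    using has_vector_derivative_zero_constant[OF convex_real_interval(5)] by blast
  then have "reject u (x t) = reject u (x 0)" if "t \<in> {0..1}" for t using that by simp
  then have "reject u (x t - x 0) = 0" if "t \<in> {0..1}" for t
    using that linear_diff[OF bounded_linear.linear[OF bounded_linear_reject[of u]], of "x t" "x 0"]
    by (metis right_minus_eq)
  then have "\<forall>t\<in>{0..1}. \<exists>c. x t - x 0 = c *\<^sub>R u" using reject_eq_0_iff[OF u] by blast
  then obtain s where "\<forall>t\<in>{0..1}. x t - x 0 = s t *\<^sub>R u" by metis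
  then have "\<forall>t\<in>{0..1}. x t = x 0 + s t *\<^sub>R u" by (metis add.commute diff_add_cancel)
  then show "straight x" unfolding straight_def using u by blast
qed

text \<open>Differentiating \<open>reject u (velocity x t) = 0\<close> makes the acceleration a
  multiple of \<open>u\<close>. Where \<alpha> is nonzero, \<open>u\<close> is itself a multiple of
  the velocity; where it vanishes, so does the velocity and the condition is trivial.\<close>

lemma direction_time_invariant_imp_parallel:
  fixes x :: "real \<Rightarrow> 'a::real_inner"
  assumes "direction_time_invariant x"
  shows "acceleration_everywhere_parallel x"
  unfolding acceleration_everywhere_parallel_def
proof (intro ballI impI)
  fix t :: real assume t: "t \<in> {0..1}" and acc: "acceleration_defined_at x t"
  obtain u \<alpha> where u: "norm u = 1" and v: "\<And>t. t \<in> {0..1} \<Longrightarrow> velocity x t = \<alpha> t *\<^sub>R u"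
    using assms unfolding direction_time_invariant_def by blast
  have "(velocity x has_vector_derivative acceleration x t) (at t within {0..1})"
    using acc by (simp add: acceleration_defined_at_def acceleration_def vector_derivative_works)
  then have d: "((\<lambda>t. reject u (velocity x t)) has_vector_derivative reject u (acceleration x t)) (at t within {0..1})"
    by (rule bounded_linear.has_vector_derivative[OF bounded_linear_reject])
  have z: "reject u (velocity x r) = 0" if "r \<in> {0..1}" for r
    using reject_eq_0_iff[OF u] v[OF that] by blast
  have "reject u (acceleration x t) = 0"
    by (rule has_vector_derivative_const_on_imp_zero[OF d _ t z]) simp_all
  then obtain c where c: "acceleration x t = c *\<^sub>R u" using reject_eq_0_iff[OF u] by blast
  show "acceleration_parallel_at x t"
  proof (cases "\<alpha> t = 0")
    case False
    then have "acceleration x t = (c / \<alpha> t) *\<^sub>R velocity x t" using c v[OF t] by simp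
    then show ?thesis unfolding acceleration_parallel_at_def by blast
  qed (simp add: acceleration_parallel_at_def v[OF t])
qed

section \<open>Motion with zero acceleration\<close>

lemma zero_acceleration_imp_velocity_const:
  fixes x :: "real \<Rightarrow> 'a::euclidean_space"
  assumes "motion_path x" "zero_acceleration x" "t \<in> {0..1}"
  shows "velocity x t = velocity x 0"
proof (rule abs_continuous_on_zero_derivative_imp_eq)
  have ac: "abs_continuous_on 0 1 (velocity x)" using assms(1) by (simp add: motion_path_def)
  then show "abs_continuous_on 0 t (velocity x)"
    using assms(3) by (auto intro: abs_continuous_on_subinterval)
  show "0 \<le> t" using assms(3) by simp
  \<comment> \<open>Almost everywhere differentiability was obtained two-sidedly on the open
    interval, so the end points join the exceptional set.\<close>
  define N where "N = {s \<in> {0<..<1}. \<not> velocity x differentiable (at s)} \<union> {0, 1}"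
  show "negligible N"
    unfolding N_def by (intro negligible_Un abs_continuous_on_AE_differentiable[OF ac]) auto
  fix s assume s: "s \<in> {0..t} - N"
  then have s01: "s \<in> {0..1}" using assms(3) by auto
  have "velocity x differentiable (at s)" using s s01 by (auto simp: N_def)
  then have d: "velocity x differentiable (at s within {0..1})" by (rule differentiable_at_withinI)
  then have "acceleration x s = 0"
    using assms(2) s01 by (simp add: zero_acceleration_def acceleration_defined_at_def)
  then have "(velocity x has_vector_derivative 0) (at s within {0..1})"
    using d by (simp add: acceleration_def vector_derivative_works)
  then show "(velocity x has_vector_derivative 0) (at s within {0..t})"
    by (rule has_vector_derivative_within_subset) (use assms(3) in auto)
qed

theorem proposition1:
  fixes x :: "real \<Rightarrow> real ^ 'd"
  assumes "motion_path x"
  shows "(straight x \<longleftrightarrow> direction_time_invariant x \<and> acceleration_everywhere_parallel x) \<and>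
    (zero_acceleration x \<longrightarrow>
       (\<forall>t\<in>{0..1}. x t = x 0 + t *\<^sub>R velocity x 0) \<and>
       straight x \<and> (\<forall>t\<in>{0..1}. velocity x t = velocity x 0))"
proof (intro conjI impI)
  show "straight x \<longleftrightarrow> direction_time_invariant x \<and> acceleration_everywhere_parallel x"
    using straight_iff_direction_time_invariant[OF assms] direction_time_invariant_imp_parallel by blast
next
  assume za: "zero_acceleration x"
  let ?w = "velocity x 0"
  show const: "\<forall>t\<in>{0..1}. velocity x t = ?w"
    using zero_acceleration_imp_velocity_const[OF assms za] by blast
  \<comment> \<open>The velocity exists and is constant at every point of [0,1], so the deviation
    from uniform motion has derivative zero throughout.\<close>
  have der: "((\<lambda>t. x t - t *\<^sub>R ?w) has_vector_derivative 0) (at t within {0..1})" if t: "t \<in> {0..1}" for t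
  proof -
    have "((\<lambda>t. t *\<^sub>R ?w) has_vector_derivative 1 *\<^sub>R ?w) (at t within {0..1})"
      by (rule bounded_linear.has_vector_derivative[OF bounded_linear_scaleR_left has_vector_derivative_id])
    from has_vector_derivative_diff[OF motion_path_derivative[OF assms t] this]
    show ?thesis by (simp add: bspec[OF const t])
  qed
  then obtain c where c: "\<And>t. t \<in> {0..1} \<Longrightarrow> x t - t *\<^sub>R ?w = c"
    using has_vector_derivative_zero_constant[OF convex_real_interval(5)] by blast
  have "x t - t *\<^sub>R ?w = x 0 - 0 *\<^sub>R ?w" if t: "t \<in> {0..1}" for t
    using c[OF t] c[of 0] by simp
  then show affine: "\<forall>t\<in>{0..1}. x t = x 0 + t *\<^sub>R ?w"
    by (metis add.commute diff_add_cancel diff_zero scaleR_zero_left)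
  \<comment> \<open>Straightness asks for a unit vector even when the motion is at rest; any
    coordinate axis then serves.\<close>
  obtain u :: "real ^ 'd" where u: "norm u = 1" "?w = norm ?w *\<^sub>R u"
  proof (cases "?w = 0")
    case True
    then show ?thesis using that[of "axis undefined 1"] by simp
  next
    case False
    then show ?thesis using that[of "sgn ?w"] by (simp add: norm_sgn sgn_div_norm)
  qed
  show "straight x"
    unfolding straight_def
    using u affine by (intro exI[of _ u] exI[of _ "\<lambda>t. t * norm ?w"]) (metis scaleR_scaleR)
qed

end
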